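(* There is an absolute constant $c_0$ such that the following holds for every constant $c\ge c_0$. Let $G=(V,E)$ be a graph with $n$ nodes and $m\ge 1$ edges, let $0<\epsilon<1/2$, let $p = c\epsilon^{-2}\log n\cdot \frac{n}{m}$, assumed to satisfy $p<1$, and let $G'$ be obtained from $G$ by keeping each edge independently with probability $p$. Let $U'=\arg\max_{U} d(G'_U)$ (over nonempty $U\subseteq V$). Then with high probability, \[\frac{1-\epsilon}{1+\epsilon}\, d^* \le d(G_{U'})\le d^*.\]
   Context: For a graph $H$ on node set $V$ and nonempty $U\subseteq V$, $H_U$ is the subgraph induced on $U$ and $d(H_U)=|E(H_U)|/|U|$ is its density. $d^*=\max_{U\subseteq V} d(G_U)$. "With high probability" means with probability at least $1-n^{-c'}$ for some constant $c'>0$. *)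

theory Defs
  imports "HOL-Probability.Probability"
begin

definition simple_graph :: "'a set \<Rightarrow> 'a set set \<Rightarrow> bool" where
  "simple_graph V E \<longleftrightarrow> finite V \<and> (\<forall>e\<in>E. e \<subseteq> V \<and> card e = 2)"

definition induced_edges :: "'a set set \<Rightarrow> 'a set \<Rightarrow> 'a set set" where
  "induced_edges E U = {e \<in> E. e \<subseteq> U}"

definition induced_density :: "'a set set \<Rightarrow> 'a set \<Rightarrow> real" where
  "induced_density E U = real (card (induced_edges E U)) / real (card U)"

definition max_density :: "'a set \<Rightarrow> 'a set set \<Rightarrow> real" where
  "max_density V E = Max (induced_density E ` {U. U \<subseteq> V \<and> U \<noteq> {}})"

text \<open>
  The law of the edge set of the sampled graph: independent Bernoulli coins
  indexed by the edges, an edge being kept iff its coin shows \<^const>\<open>True\<close>.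
  The node set does not change.
\<close>

definition sampled_edges :: "'a set set \<Rightarrow> real \<Rightarrow> 'a set set pmf" where
  "sampled_edges E p =
     map_pmf (\<lambda>keep. {e \<in> E. keep e}) (Pi_pmf E False (\<lambda>_. bernoulli_pmf p))"

text \<open>
  The argmax need not be unique, so a densest node set is any maximiser.
\<close>

definition densest_set :: "'a set \<Rightarrow> 'a set set \<Rightarrow> 'a set \<Rightarrow> bool" where
  "densest_set V E U \<longleftrightarrow> is_arg_max (induced_density E) (\<lambda>W. W \<subseteq> V \<and> W \<noteq> {}) U"

end

theory Submission
  imports Defs
begin

text \<open>
  Put \<open>\<delta> = \<epsilon> / (1 + \<epsilon>)\<close>, so that \<open>1 - 2\<delta> = (1 - \<epsilon>) / (1 + \<epsilon>)\<close>. It suffices that no node set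
  \<open>U\<close> has sampled density exceeding \<open>p d(G\<^sub>U) + \<delta> p d\<^sup>*\<close> and that one fixed densest set of \<open>G\<close> keeps
  sampled density above \<open>(1 - \<delta>) p d\<^sup>*\<close>. As \<open>d\<^sup>* \<ge> m / n\<close>, the mean scale \<open>p |U| d\<^sup>*\<close> is at least
  \<open>c \<epsilon>\<^sup>-\<^sup>2 |U| ln n\<close>, and a Chernoff bound with deviation measured on that scale fails for \<open>U\<close> with
  probability at most \<open>n\<^sup>-\<^sup>4\<^sup>|\<^sup>U\<^sup>|\<close>, which is summable over all \<open>U\<close>.
\<close>

section \<open>Chernoff bound for the number of sampled edges in a fixed set\<close>

text \<open>Both tails need the estimate, hence both signs of \<open>t\<close>. For
  \<open>t = - x\<close> with \<open>x > 0\<close> it follows from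
  \<open>(1 - x + x\<^sup>2) * (1 + x) = 1 + x ^ 3 \<ge> 1\<close> and
  \<open>1 + x \<le> exp x\<close>.\<close>

lemma exp_le_quadratic:
  fixes t :: real
  assumes "\<bar>t\<bar> \<le> 1"
  shows "exp t \<le> 1 + t + t\<^sup>2"
proof (cases "t \<ge> 0")
  case True
  then show ?thesis using exp_bound[of t] assms by simp
next
  case False
  define x where "x = - t"
  have x: "0 < x" using False by (simp add: x_def)
  have "1 \<le> 1 + x ^ 3" using x by simp
  also have "\<dots> = (1 - x + x\<^sup>2) * (1 + x)"
    by (simp add: algebra_simps power2_eq_square power3_eq_cube)
  also have "\<dots> \<le> (1 - x + x\<^sup>2) * exp x"
  proof (rule mult_left_mono)
    show "0 \<le> 1 - x + x\<^sup>2" using assms by (simp add: x_def)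
  qed (rule exp_ge_add_one_self)
  finally have "1 / exp x \<le> 1 - x + x\<^sup>2" by (simp add: divide_simps)
  then show ?thesis by (simp add: x_def exp_minus inverse_eq_divide)
qed

lemma finite_set_pmf_sampled_edges:
  assumes "finite E"
  shows "finite (set_pmf (sampled_edges E p))"
proof (rule finite_subset)
  show "set_pmf (sampled_edges E p) \<subseteq> Pow E"
    by (auto simp: sampled_edges_def)
qed (use assms in simp)

text \<open>The exponential of a count is a product of one factor per edge, and independence of the
  coins turns the expectation of the product into a product of expectations.\<close>

lemma sampled_edges_mgf:
  fixes t p :: real
  assumes "finite E" "F \<subseteq> E" "0 \<le> p" "p \<le> 1"
  shows "measure_pmf.expectation (sampled_edges E p) (\<lambda>E'. exp (t * real (card (E' \<inter> F))))
           = (1 + p * (exp t - 1)) ^ card F"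
proof -
  \<comment> \<open>Edges outside \<open>F\<close> get the constant factor 1, so the product can
    range over all of \<open>E\<close>, the index set of the coins.\<close>
  define g where "g e b = (if e \<in> F \<and> b then exp t else 1)" for e b
  have g: "exp (t * real (card ({e \<in> E. keep e} \<inter> F))) = (\<Prod>e\<in>E. g e (keep e))" for keep
  proof -
    have "(\<Prod>e\<in>E. g e (keep e)) = (\<Prod>e\<in>{e \<in> E. keep e} \<inter> F. g e (keep e))"
      by (rule prod.mono_neutral_right) (use assms(1) in \<open>auto simp: g_def\<close>)
    also have "\<dots> = (\<Prod>e\<in>{e \<in> E. keep e} \<inter> F. exp t)"
      by (rule prod.cong) (auto simp: g_def)
    also have "\<dots> = exp (t * real (card ({e \<in> E. keep e} \<inter> F)))"
      by (simp add: exp_of_nat2_mult)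
    finally show ?thesis ..
  qed
  have "measure_pmf.expectation (sampled_edges E p) (\<lambda>E'. exp (t * real (card (E' \<inter> F))))
      = measure_pmf.expectation (Pi_pmf E False (\<lambda>_. bernoulli_pmf p)) (\<lambda>y. \<Prod>e\<in>E. g e (y e))"
    by (simp add: sampled_edges_def g)
  also have "\<dots> = (\<Prod>e\<in>E. measure_pmf.expectation (bernoulli_pmf p) (g e))"
    by (rule expectation_prod_Pi_pmf) (auto simp: assms(1) g_def intro!: integrable_measure_pmf_finite)
  also have "\<dots> = (\<Prod>e\<in>E. if e \<in> F then 1 + p * (exp t - 1) else 1)"
    by (rule prod.cong) (use assms in \<open>auto simp: g_def algebra_simps\<close>)
  also have "\<dots> = (\<Prod>e\<in>F. 1 + p * (exp t - 1))"
    using assms by (intro prod.mono_neutral_cong_right) auto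
  finally show ?thesis by simp
qed

text \<open>
  The sign \<open>s\<close> selects the upper or the lower tail. The deviation is relative to an upper bound \<open>M\<close>
  of the mean: the bound must not degrade for node sets that span few edges.
\<close>

lemma sampled_edges_chernoff:
  fixes s \<delta> M p :: real
  assumes "finite E" "F \<subseteq> E" "0 \<le> p" "p \<le> 1"
    and s: "\<bar>s\<bar> = 1" and \<delta>: "0 \<le> \<delta>" "\<delta> \<le> 1" and M: "p * real (card F) \<le> M"
  shows "measure_pmf.prob (sampled_edges E p)
           {E'. s * (p * real (card F)) + \<delta> * M \<le> s * real (card (E' \<inter> F))} \<le> exp (- M * \<delta>\<^sup>2 / 4)"
proof -
  \<comment> \<open>With \<open>t = s * \<tau>\<close> the exponent is at most
    \<open>M * \<tau>\<^sup>2 - \<tau> * \<delta> * M\<close>; \<open>\<tau> = \<delta> / 2\<close>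
    minimises this, with value \<open>- M * \<delta>\<^sup>2 / 4\<close>. The number
    \<open>a\<close> is \<open>\<tau>\<close> times the threshold.\<close>
  define t where "t = s * \<delta> / 2"
  define \<mu> where "\<mu> = p * real (card F)"
  define a where "a = \<delta> / 2 * (s * \<mu> + \<delta> * M)"
  have \<mu>: "0 \<le> \<mu>" using assms by (simp add: \<mu>_def)
  have s2: "s\<^sup>2 = 1" using s by (metis power2_abs one_power2)
  have t: "\<bar>t\<bar> \<le> 1" "t\<^sup>2 = \<delta>\<^sup>2 / 4"
    using s s2 \<delta> by (auto simp: t_def abs_mult power_mult_distrib power_divide)
  let ?P = "measure_pmf (sampled_edges E p)"
  let ?u = "\<lambda>E'. exp (t * real (card (E' \<inter> F)))"
  have "measure ?P {E'. s * \<mu> + \<delta> * M \<le> s * real (card (E' \<inter> F))}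
      \<le> measure ?P {E' \<in> space ?P. exp a \<le> ?u E'}"
  proof (rule measure_pmf.finite_measure_mono)
    show "{E'. s * \<mu> + \<delta> * M \<le> s * real (card (E' \<inter> F))} \<subseteq> {E' \<in> space ?P. exp a \<le> ?u E'}"
    proof
      fix E' assume "E' \<in> {E'. s * \<mu> + \<delta> * M \<le> s * real (card (E' \<inter> F))}"
      then have "\<delta> / 2 * (s * \<mu> + \<delta> * M) \<le> \<delta> / 2 * (s * real (card (E' \<inter> F)))"
        using \<delta> by (intro mult_left_mono) auto
      then show "E' \<in> {E' \<in> space ?P. exp a \<le> ?u E'}" by (simp add: a_def t_def mult_ac)
    qed
  qed simp
  also have "\<dots> \<le> measure_pmf.expectation (sampled_edges E p) ?u / exp a"
    by (rule integral_Markov_inequality_measure[where A = "{}"])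
       (use assms(1) in \<open>auto intro: integrable_measure_pmf_finite finite_set_pmf_sampled_edges\<close>)
  also have "\<dots> = (1 + p * (exp t - 1)) ^ card F / exp a"
    using assms by (simp add: sampled_edges_mgf)
  also have "\<dots> \<le> exp (p * (exp t - 1)) ^ card F / exp a"
  proof (intro divide_right_mono power_mono)
    have "0 \<le> (1 - p) + p * exp t" using assms by simp
    then show "0 \<le> 1 + p * (exp t - 1)" by (simp add: algebra_simps)
  qed (auto intro: exp_ge_add_one_self)
  also have "\<dots> = exp (\<mu> * (exp t - 1) - a)"
    by (simp add: exp_diff \<mu>_def mult_ac flip: exp_of_nat_mult)
  also have "\<dots> \<le> exp (- M * \<delta>\<^sup>2 / 4)"
  proof -
    have "\<mu> * (exp t - 1) \<le> \<mu> * (t + t\<^sup>2)"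
      using exp_le_quadratic[OF t(1)] \<mu> by (intro mult_left_mono) auto
    \<comment> \<open>Only the quadratic term is enlarged from \<open>\<mu>\<close> to
      \<open>M\<close>. The linear term stays exact and cancels against the part
      \<open>\<delta> / 2 * s * \<mu>\<close> of \<open>a\<close>; this works for either sign of
      \<open>s\<close>.\<close>
    moreover have "\<mu> * t\<^sup>2 \<le> M * t\<^sup>2" using M by (intro mult_right_mono) (auto simp: \<mu>_def)
    ultimately have "\<mu> * (exp t - 1) - a \<le> \<mu> * t + M * t\<^sup>2 - a" by (simp add: algebra_simps)
    also have "\<dots> = - M * \<delta>\<^sup>2 / 4"
      by (subst t(2)) (simp add: a_def t_def field_simps power2_eq_square)
    finally show ?thesis by simp
  qed
  finally show ?thesis by (simp add: \<mu>_def)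
qed

section \<open>Densities and the deterministic comparison\<close>

lemma induced_density_le_max_density:
  assumes "finite V" "U \<subseteq> V" "U \<noteq> {}"
  shows "induced_density E U \<le> max_density V E"
  unfolding max_density_def by (rule Max_ge) (use assms in auto)

lemma max_density_attained:
  assumes "finite V" "V \<noteq> {}"
  obtains U where "U \<subseteq> V" "U \<noteq> {}" "induced_density E U = max_density V E"
proof -
  have "max_density V E \<in> induced_density E ` {U. U \<subseteq> V \<and> U \<noteq> {}}"
    unfolding max_density_def by (rule Max_in) (use assms in auto)
  then obtain U where "U \<in> {U. U \<subseteq> V \<and> U \<noteq> {}}" "max_density V E = induced_density E U" ..
  then show ?thesis using that[of U] by simp
qed

lemma card_induced_edges_eq:
  assumes "finite U" "U \<noteq> {}"
  shows "real (card (induced_edges E U)) = real (card U) * induced_density E U"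
  using assms by (simp add: induced_density_def)

text \<open>After division by the set sizes, sampled densities satisfy \<open>(1 - \<delta>) p d <
  d'(U0) \<le> d'(U') < p d(U') + \<delta> p d\<close>, where \<open>d\<close> alone is the maximal
  density. The upper estimate is required for all \<open>U\<close> because \<open>U'\<close> depends
  on the sample; the lower one concerns a single fixed set.\<close>

lemma densest_set_approx:
  fixes \<delta> p :: real
  assumes "finite V" "E' \<subseteq> E" "0 < p"
    and upper: "\<And>U. U \<subseteq> V \<Longrightarrow> U \<noteq> {} \<Longrightarrow> real (card (E' \<inter> induced_edges E U))
          < p * real (card (induced_edges E U)) + \<delta> * (p * real (card U) * max_density V E)"
    and U0: "U0 \<subseteq> V" "U0 \<noteq> {}" "induced_density E U0 = max_density V E"
    and lower: "p * real (card (induced_edges E U0)) - \<delta> * (p * real (card U0) * max_density V E)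
          < real (card (E' \<inter> induced_edges E U0))"
    and U': "densest_set V E' U'"
  shows "(1 - 2 * \<delta>) * max_density V E \<le> induced_density E U'"
proof -
  let ?d = "max_density V E"
  have sub: "E' \<inter> induced_edges E U = induced_edges E' U" for U
    using assms(2) by (auto simp: induced_edges_def)
  have U'V: "U' \<subseteq> V" "U' \<noteq> {}" and max: "induced_density E' U0 \<le> induced_density E' U'"
    using U' U0 by (auto simp: densest_set_def is_arg_max_def not_less)
  have fin: "finite U0" "finite U'" using assms(1) U0(1) U'V(1) finite_subset by auto
  have pos: "0 < real (card U0)" "0 < real (card U')" using fin U0(2) U'V(2) by (auto simp: card_gt_0_iff)
  have "real (card U0) * (p * ?d - \<delta> * (p * ?d)) < real (card U0) * induced_density E' U0"
    using lower U0 fin by (simp add: sub card_induced_edges_eq algebra_simps)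
  then have 1: "p * ?d - \<delta> * (p * ?d) < induced_density E' U0" using pos by simp
  have "real (card U') * induced_density E' U'
      < real (card U') * (p * induced_density E U' + \<delta> * (p * ?d))"
    using upper[OF U'V] U'V fin by (simp add: sub card_induced_edges_eq algebra_simps)
  then have 2: "induced_density E' U' < p * induced_density E U' + \<delta> * (p * ?d)" using pos by simp
  have "p * ((1 - 2 * \<delta>) * ?d) \<le> p * induced_density E U'"
    using 1 2 max by (simp add: algebra_simps)
  then show ?thesis using assms(3) by simp
qed

section \<open>Union bound over all node sets\<close>

text \<open>Expand the product of \<open>x + 1\<close> over \<open>V\<close>: a subset records the
  factors from which \<open>x\<close> is taken.\<close>

lemma sum_power_card_Pow:
  fixes x :: "'b :: comm_semiring_1"
  assumes "finite V"
  shows "(\<Sum>U\<in>Pow V. x ^ card U) = (1 + x) ^ card V"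
  using prod_add[OF assms, of "\<lambda>_. x" "\<lambda>_. 1"] by (simp add: add.commute)

lemma densest_set_failure_prob:
  fixes V :: "'a set" and E :: "'a set set" and c \<epsilon> p :: real
  assumes G: "simple_graph V E" and m: "card E \<ge> 1" and \<epsilon>: "0 < \<epsilon>" "\<epsilon> < 1/2" and c: "36 \<le> c"
    and p: "p = c * (1 / \<epsilon>\<^sup>2) * ln (real (card V)) * (real (card V) / real (card E))" "p < 1"
  shows "measure_pmf.prob (sampled_edges E p)
           {E'. \<exists>U'. densest_set V E' U' \<and>
              induced_density E U' < (1 - \<epsilon>) / (1 + \<epsilon>) * max_density V E} \<le> 1 / real (card V)"
proof -
  define n where "n = card V"
  define d where "d = max_density V E"
  define \<delta> where "\<delta> = \<epsilon> / (1 + \<epsilon>)"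
  define M where "M U = p * real (card U) * d" for U :: "'a set"
  define x where "x = 1 / real n ^ 4"
  have finV: "finite V" using G by (simp add: simple_graph_def)
  have finE: "finite E"
    by (rule finite_subset[of _ "Pow V"]) (use G in \<open>auto simp: simple_graph_def\<close>)
  obtain e where "e \<in> E" using m by fastforce
  then have "e \<subseteq> V" "card e = 2" using G by (auto simp: simple_graph_def)
  then have n: "n \<ge> 2" using card_mono[OF finV] by (metis n_def)
  then have Vne: "V \<noteq> {}" by (auto simp: n_def)
  have ln: "ln (real n) > 0" using n by simp
  have p0: "0 < p" unfolding p(1) n_def[symmetric] using ln n m \<epsilon> c by simp
  \<comment> \<open>The factor 2/3 comes from \<open>1 + \<epsilon> < 3 / 2\<close>.\<close>
  have \<delta>: "0 \<le> \<delta>" "\<delta> \<le> 1" "2 / 3 * \<epsilon> \<le> \<delta>" and \<delta>2: "1 - 2 * \<delta> = (1 - \<epsilon>) / (1 + \<epsilon>)"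
    using \<epsilon> by (auto simp: \<delta>_def field_simps)
  \<comment> \<open>Testing the maximum at \<open>V\<close> gives \<open>d \<ge> m / n\<close>; the
    factor \<open>n / m\<close> in \<open>p\<close> then cancels.\<close>
  have "induced_edges E V = E" using G by (auto simp: induced_edges_def simple_graph_def)
  then have "real (card E) / real n \<le> d"
    using induced_density_le_max_density[OF finV subset_refl Vne, of E]
    by (simp add: d_def induced_density_def n_def)
  then have "p * (real (card E) / real n) \<le> p * d" using p0 by (intro mult_left_mono) auto
  moreover have "p * (real (card E) / real n) = c / \<epsilon>\<^sup>2 * ln (real n)"
    using n m unfolding p(1) n_def[symmetric] by simp
  ultimately have pd: "c / \<epsilon>\<^sup>2 * ln (real n) \<le> p * d" by simp
  \<comment> \<open>This is where 36 arises:
    \<open>(2 / 3 * \<epsilon>)\<^sup>2 / 4 = \<epsilon>\<^sup>2 / 9\<close>, and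
    \<open>c / 9 \<ge> 4\<close>.\<close>
  have "4 * ln (real n) \<le> p * d * \<delta>\<^sup>2 / 4"
  proof -
    have "4 * ln (real n) \<le> c / 9 * ln (real n)" using c ln by simp
    also have "\<dots> = c / \<epsilon>\<^sup>2 * ln (real n) * (2 / 3 * \<epsilon>)\<^sup>2 / 4"
      using \<epsilon> by (simp add: field_simps power2_eq_square)
    also have "\<dots> \<le> p * d * \<delta>\<^sup>2 / 4"
    proof (intro divide_right_mono mult_mono[OF pd] power_mono)
      show "0 \<le> p * d" using order_trans[OF _ pd, of 0] ln c by simp
    qed (use \<delta> \<epsilon> in auto)
    finally show ?thesis .
  qed
  then have "exp (- (p * d * \<delta>\<^sup>2 / 4)) \<le> exp (- (4 * ln (real n)))" by simp
  also have "\<dots> = x"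
    using n by (simp add: x_def exp_minus inverse_eq_divide exp_of_nat_mult[of 4, simplified])
  finally have x: "exp (- (p * d * \<delta>\<^sup>2 / 4)) \<le> x" .
  \<comment> \<open>\<open>M U\<close> is proportional to \<open>card U\<close>, so the bound for
    one node is raised to the power \<open>card U\<close>.\<close>
  have tail: "exp (- M U * \<delta>\<^sup>2 / 4) \<le> x ^ card U" for U
  proof -
    have "exp (- M U * \<delta>\<^sup>2 / 4) = exp (- (p * d * \<delta>\<^sup>2 / 4)) ^ card U"
      by (simp add: M_def mult_ac flip: exp_of_nat_mult)
    also have "\<dots> \<le> x ^ card U" using x by (intro power_mono) auto
    finally show ?thesis .
  qed
  obtain U0 where U0: "U0 \<subseteq> V" "U0 \<noteq> {}" "induced_density E U0 = d"
    using max_density_attained[OF finV Vne] unfolding d_def by blast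
  define X where "X U E' = real (card (E' \<inter> induced_edges E U))" for U E'
  define \<mu> where "\<mu> U = p * real (card (induced_edges E U))" for U
  \<comment> \<open>The event that \<open>U\<close> deviates upwards for \<open>s = 1\<close> and
    downwards for \<open>s = - 1\<close>.\<close>
  define dev where "dev s U = {E'. s * \<mu> U + \<delta> * M U \<le> s * X U E'}" for s :: real and U
  let ?P = "measure_pmf (sampled_edges E p)"
  let ?N = "Pow V - {{}}"
  have dev: "measure ?P (dev s U) \<le> x ^ card U" if "U \<subseteq> V" "U \<noteq> {}" "\<bar>s\<bar> = 1" for s U
  proof -
    have "finite U" using that(1) finV finite_subset by blast
    \<comment> \<open>Maximality of \<open>d\<close> makes \<open>M U\<close> an upper bound of the
      mean, as the Chernoff bound requires.\<close>
    then have "real (card (induced_edges E U)) \<le> real (card U) * d"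
      using induced_density_le_max_density[OF finV that(1,2), of E] that(2)
      by (simp add: card_induced_edges_eq d_def mult_left_mono)
    then have "p * real (card (induced_edges E U)) \<le> M U" using p0 by (simp add: M_def)
    moreover have "induced_edges E U \<subseteq> E" by (auto simp: induced_edges_def)
    ultimately have "measure ?P (dev s U) \<le> exp (- M U * \<delta>\<^sup>2 / 4)"
      unfolding dev_def \<mu>_def X_def
      using p0 p(2) \<delta> finE that(3) by (intro sampled_edges_chernoff) auto
    then show ?thesis using tail[of U] by simp
  qed
  let ?B = "{E'. \<exists>U'. densest_set V E' U' \<and> induced_density E U' < (1 - \<epsilon>) / (1 + \<epsilon>) * d}"
  have "measure ?P ?B \<le> measure ?P ((\<Union>U\<in>?N. dev 1 U) \<union> dev (-1) U0)"
  \<comment> \<open>The inclusion is shown on the support only, where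
    \<open>E' \<subseteq> E\<close>.\<close>
  proof (rule measure_pmf.finite_measure_mono_AE)
    show "AE E' in ?P. E' \<in> ?B \<longrightarrow> E' \<in> (\<Union>U\<in>?N. dev 1 U) \<union> dev (-1) U0"
    proof (intro AE_pmfI impI)
      fix E' assume E': "E' \<in> set_pmf (sampled_edges E p)" and B: "E' \<in> ?B"
      have sub: "E' \<subseteq> E" using E' by (auto simp: sampled_edges_def)
      show "E' \<in> (\<Union>U\<in>?N. dev 1 U) \<union> dev (-1) U0"
      proof (rule ccontr)
        assume contra: "\<not> ?thesis"
        obtain U' where U': "densest_set V E' U'"
            "induced_density E U' < (1 - \<epsilon>) / (1 + \<epsilon>) * d" using B by blast
        have "(1 - 2 * \<delta>) * max_density V E \<le> induced_density E U'"
        proof (rule densest_set_approx[OF finV sub p0 _ U0[unfolded d_def] _ U'(1)])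
          fix U assume "U \<subseteq> V" "U \<noteq> {}"
          then show "real (card (E' \<inter> induced_edges E U))
              < p * real (card (induced_edges E U)) + \<delta> * (p * real (card U) * max_density V E)"
            using contra by (auto simp: dev_def X_def \<mu>_def M_def d_def not_le)
        next
          show "p * real (card (induced_edges E U0)) - \<delta> * (p * real (card U0) * max_density V E)
              < real (card (E' \<inter> induced_edges E U0))"
            using contra by (auto simp: dev_def X_def \<mu>_def M_def d_def not_le)
        qed
        then show False using U'(2) \<delta>2 by (simp add: d_def)
      qed
    qed
  qed simp
  also have "\<dots> \<le> (\<Sum>U\<in>?N. measure ?P (dev 1 U)) + measure ?P (dev (-1) U0)"
    by (intro order_trans[OF measure_Un_le] add_right_mono measure_UNION_le) (use finV in auto)
  also have "\<dots> \<le> (\<Sum>U\<in>?N. x ^ card U) + x ^ card U0"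
    using dev U0 by (intro add_mono sum_mono) auto
  \<comment> \<open>The subtracted 1 is the term of the empty set.\<close>
  also have "(\<Sum>U\<in>?N. x ^ card U) = (1 + x) ^ n - 1"
    using finV by (simp add: sum_diff1 sum_power_card_Pow n_def)
  also have "(1 + x) ^ n - 1 + x ^ card U0 \<le> 1 / real n"
  proof -
    \<comment> \<open>In terms of \<open>r = 1 / n\<close> the sum over \<open>?N\<close> is at most
      \<open>2 * r ^ 3\<close> and the term of \<open>U0\<close> at most \<open>r ^ 3\<close>; since
      \<open>r \<le> 1 / 2\<close>, the total \<open>3 * r ^ 3\<close> is at most
      \<open>3 / 4 * r\<close>.\<close>
    define r where "r = 1 / real n"
    have r: "0 < r" "r \<le> 1 / 2" using n by (auto simp: r_def field_simps)
    have xr: "x = r ^ 4" by (simp add: x_def r_def power_divide)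
    have x01: "0 \<le> x" "x \<le> 1" using r by (auto simp: xr power_le_one)
    have nx: "real n * x = r ^ 3" using n by (simp add: x_def r_def field_simps power_numeral_reduce)
    have r2: "r ^ 2 \<le> 1 / 4" using power_mono[OF r(2), of 2] r by (simp add: power2_eq_square)
    have r3: "r ^ 3 \<le> r / 4" using mult_left_mono[OF r2, of r] r by (simp add: power_numeral_reduce)
    have "(1 + x) ^ n \<le> exp x ^ n" using x01 by (intro power_mono) auto
    also have "\<dots> = exp (r ^ 3)" by (simp add: nx flip: exp_of_nat_mult)
    also have "\<dots> \<le> 1 + r ^ 3 + (r ^ 3)\<^sup>2" using r by (intro exp_bound) (auto simp: power_le_one)
    also have "(r ^ 3)\<^sup>2 \<le> r ^ 3"
      using r power_decreasing[of 3 6 r] by (simp flip: power_mult)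
    finally have 1: "(1 + x) ^ n \<le> 1 + 2 * r ^ 3" by simp
    have "card U0 \<noteq> 0" using U0 finV finite_subset by (metis card_0_eq)
    then have "x ^ card U0 \<le> x" using x01 power_decreasing[of 1 "card U0" x] by simp
    also have "x \<le> r ^ 3" unfolding xr using r by (intro power_decreasing) auto
    finally show ?thesis using 1 r3 r by (simp flip: r_def)
  qed
  finally show ?thesis by (simp add: d_def n_def)
qed

theorem theorem1:
  "\<exists>c0::real. c0 > 0 \<and> (\<forall>c\<ge>c0. \<exists>c'::real. c' > 0 \<and>
     (\<forall>(V::'a set) (E::'a set set) (n::nat) (m::nat) (\<epsilon>::real) (p::real).
        simple_graph V E \<longrightarrow> card V = n \<longrightarrow> card E = m \<longrightarrow> m \<ge> 1 \<longrightarrow>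
        0 < \<epsilon> \<longrightarrow> \<epsilon> < 1/2 \<longrightarrow>
        p = c * (1 / \<epsilon>\<^sup>2) * ln (real n) * (real n / real m) \<longrightarrow> p < 1 \<longrightarrow>
        measure_pmf.prob (sampled_edges E p)
          {E'. \<forall>U'. densest_set V E' U' \<longrightarrow>
                 (1 - \<epsilon>) / (1 + \<epsilon>) * max_density V E \<le> induced_density E U' \<and>
                 induced_density E U' \<le> max_density V E}
        \<ge> 1 - real n powr (- c')))"
proof (rule exI[of _ 36], intro conjI allI impI)
  fix c :: real assume c: "36 \<le> c"
  show "\<exists>c'::real. c' > 0 \<and>
     (\<forall>(V::'a set) (E::'a set set) (n::nat) (m::nat) (\<epsilon>::real) (p::real).
        simple_graph V E \<longrightarrow> card V = n \<longrightarrow> card E = m \<longrightarrow> m \<ge> 1 \<longrightarrow>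
        0 < \<epsilon> \<longrightarrow> \<epsilon> < 1/2 \<longrightarrow>
        p = c * (1 / \<epsilon>\<^sup>2) * ln (real n) * (real n / real m) \<longrightarrow> p < 1 \<longrightarrow>
        measure_pmf.prob (sampled_edges E p)
          {E'. \<forall>U'. densest_set V E' U' \<longrightarrow>
                 (1 - \<epsilon>) / (1 + \<epsilon>) * max_density V E \<le> induced_density E U' \<and>
                 induced_density E U' \<le> max_density V E}
        \<ge> 1 - real n powr (- c'))"
  \<comment> \<open>The failure bound \<open>1 / n\<close> allows \<open>c' = 1\<close> for every
    \<open>c\<close>.\<close>
  proof (rule exI[of _ 1], intro conjI allI impI)
    fix V :: "'a set" and E :: "'a set set" and n m :: nat and \<epsilon> p :: real
    assume G: "simple_graph V E" and n: "card V = n" and m: "card E = m" "m \<ge> 1"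
      and \<epsilon>: "0 < \<epsilon>" "\<epsilon> < 1/2"
      and p: "p = c * (1 / \<epsilon>\<^sup>2) * ln (real n) * (real n / real m)" "p < 1"
    let ?bad = "{E'. \<exists>U'. densest_set V E' U' \<and>
              induced_density E U' < (1 - \<epsilon>) / (1 + \<epsilon>) * max_density V E}"
    let ?good = "{E'. \<forall>U'. densest_set V E' U' \<longrightarrow>
                 (1 - \<epsilon>) / (1 + \<epsilon>) * max_density V E \<le> induced_density E U' \<and>
                 induced_density E U' \<le> max_density V E}"
    \<comment> \<open>The upper inequality holds for every sample, because \<open>U'\<close>
      competes in the maximum over \<open>V\<close>. Hence only the lower inequality can fail, and
      the good event is the complement of the bad one.\<close>
    have "finite V" using G by (simp add: simple_graph_def)
    then have "induced_density E U' \<le> max_density V E" if "densest_set V E' U'" for E' U'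
      using that by (auto simp: densest_set_def is_arg_max_def intro: induced_density_le_max_density)
    then have "?good = - ?bad" by (auto simp: not_less)
    then have "measure_pmf.prob (sampled_edges E p) ?good
        = 1 - measure_pmf.prob (sampled_edges E p) ?bad"
      by (simp add: measure_pmf.prob_compl[of _ "sampled_edges E p", simplified] Compl_eq_Diff_UNIV)
    moreover have "measure_pmf.prob (sampled_edges E p) ?bad \<le> 1 / real n"
      using densest_set_failure_prob[OF G _ \<epsilon> c, of p] m p n by simp
    moreover have "real n powr (- 1) = 1 / real n"
      by (simp add: powr_minus_divide)
    ultimately show "measure_pmf.prob (sampled_edges E p) ?good \<ge> 1 - real n powr (- 1)"
      by simp
  qed simp
qed simp

end
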